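(* Let $(Z_n)_{n\ge 0}$ be a $\mathbb Z$-valued process with stationary increments. Let $\mathcal R_n:=\#\{Z_1,\ldots,Z_n\}$ and $T_0:=\inf\{n\ge 1: Z_n=0\}$. Then for every $n\ge 1$, $$\mathbb P(T_0>n)\le \frac{\mathbb E[\mathcal R_n]}{n}.$$ Further: (a) If there exists $y>1$ such that $\liminf_{n\to+\infty}\frac{\mathbb E[\mathcal R_{\lfloor yn\rfloor}]}{\mathbb E[\mathcal R_n]}>1$, then $\liminf_{n\to+\infty}\frac{n}{\mathbb E[\mathcal R_n]}\mathbb P(T_0>n)>0$. (b) If the sequence $(\mathbb E[\mathcal R_n])_{n\ge 1}$ is regularly varying with exponent $\gamma\in(0,1)$, then $\lim_{n\to+\infty}\frac{n}{\mathbb E[\mathcal R_n]}\mathbb P(T_0>n)=\gamma$. (c) If $\mathbb P(Z_1\in\{-1,0,1\})=1$, if the processes $(Z_n)_n$ and $(-Z_n)_n$ have the same distribution, and if $\lim_{n\to+\infty}\frac{n}{\mathbb E[\mathcal R_n]}\mathbb P(T_0>n)=\gamma$ for some $\gamma\in(0,1)$, then, with $Z_n^*:=\max_{k=1,\ldots,n}Z_k$, $$\mathbb P(Z_n^*\le -1)=\tfrac12\,\mathbb P(T_0>n)\sim\frac{\gamma\,\mathbb E[\mathcal R_n]}{2n}\qquad\text{as } n\to+\infty,$$ where the equality holds for every $n\ge 1$.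
   Context: A discrete-time process $(Z_n)_{n\ge 0}$ has stationary increments if for every integer $k\ge 0$ the sequences $(Z_{n+k}-Z_k)_{n\ge 0}$ and $(Z_n)_{n\ge 0}$ have the same law (in particular $Z_0=0$ almost surely). Convention: $\inf\emptyset=+\infty$. A sequence $(u_n)$ of positive numbers is regularly varying with exponent $\gamma$ if $u_{\lfloor xn\rfloor}/u_n\to x^\gamma$ for every $x>0$. *)

theory Defs
  imports "HOL-Probability.Probability" "HOL-Library.Extended_Nat" "HOL-Library.Landau_Symbols"
begin

definition process_law :: "'a measure \<Rightarrow> (nat \<Rightarrow> 'a \<Rightarrow> int) \<Rightarrow> (nat \<Rightarrow> int) measure" where
  "process_law M Z =
     distr M (\<Pi>\<^sub>M n\<in>(UNIV :: nat set). count_space (UNIV :: int set)) (\<lambda>\<omega> n. Z n \<omega>)"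

definition int_process :: "'a measure \<Rightarrow> (nat \<Rightarrow> 'a \<Rightarrow> int) \<Rightarrow> bool" where
  "int_process M Z \<longleftrightarrow> (\<forall>n. Z n \<in> M \<rightarrow>\<^sub>M count_space UNIV)"

(* Taking n = 0 shows that Z 0 = 0 almost surely. *)
definition stationary_increments :: "'a measure \<Rightarrow> (nat \<Rightarrow> 'a \<Rightarrow> int) \<Rightarrow> bool" where
  "stationary_increments M Z \<longleftrightarrow>
     (\<forall>k. process_law M (\<lambda>n \<omega>. Z (n + k) \<omega> - Z k \<omega>) = process_law M Z)"

definition range_size :: "(nat \<Rightarrow> 'a \<Rightarrow> int) \<Rightarrow> nat \<Rightarrow> 'a \<Rightarrow> nat" where
  "range_size Z n \<omega> = card ((\<lambda>k. Z k \<omega>) ` {1..n})"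

definition mean_range :: "'a measure \<Rightarrow> (nat \<Rightarrow> 'a \<Rightarrow> int) \<Rightarrow> nat \<Rightarrow> real" where
  "mean_range M Z n = (\<integral>\<omega>. real (range_size Z n \<omega>) \<partial>M)"

(* In enat the infimum of the empty set is \<infinity>. *)
definition return_time :: "(nat \<Rightarrow> 'a \<Rightarrow> int) \<Rightarrow> 'a \<Rightarrow> enat" where
  "return_time Z \<omega> = Inf (enat ` {n. n \<ge> 1 \<and> Z n \<omega> = 0})"

definition no_return_prob :: "'a measure \<Rightarrow> (nat \<Rightarrow> 'a \<Rightarrow> int) \<Rightarrow> nat \<Rightarrow> real" where
  "no_return_prob M Z n = measure M {\<omega> \<in> space M. return_time Z \<omega> > enat n}"

(* Meaningful for n \<ge> 1 only. *)
definition running_max :: "(nat \<Rightarrow> 'a \<Rightarrow> int) \<Rightarrow> nat \<Rightarrow> 'a \<Rightarrow> int" where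
  "running_max Z n \<omega> = Max ((\<lambda>k. Z k \<omega>) ` {1..n})"

(* The sequence is indexed by n \<ge> 1: for x < 1 the junk index 0 occurs for finitely many n only. *)
definition regularly_varying :: "(nat \<Rightarrow> real) \<Rightarrow> real \<Rightarrow> bool" where
  "regularly_varying u \<gamma> \<longleftrightarrow>
     (\<forall>n\<ge>1. u n > 0) \<and>
     (\<forall>x>0. (\<lambda>n. u (nat \<lfloor>x * real n\<rfloor>) / u n) \<longlonglongrightarrow> x powr \<gamma>)"

end

theory Submission
  imports Defs
begin

text \<open>
  Write \<open>p m = P(T\<^sub>0 > m)\<close>. Counting each visited point at its last visit before time \<open>n\<close> and
  shifting the increments gives \<open>E[R\<^sub>n] = p 0 + \<dots> + p (n - 1)\<close>. As \<open>p\<close> is nonincreasing, comparing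
  the block sums of \<open>p\<close> over \<open>[n, yn)\<close> and \<open>[xn, n)\<close> with \<open>p n\<close> yields the bound and parts (a), (b);
  for (b) one lets \<open>x\<close> tend to 1 and recognises the derivative of \<open>x\<^sup>\<gamma>\<close> at 1. In (c) a path with
  steps in \<open>{-1, 0, 1}\<close> that avoids 0 has constant sign, and both signs are equally likely.
\<close>

section \<open>Last occurrences and partial sums of nonincreasing sequences\<close>

text \<open>Each value attained on \<open>A\<close> has exactly one last index. Prepending a new
  minimum \<open>b\<close> changes nothing for the indices in \<open>A\<close>, and \<open>b\<close>
  itself counts exactly when its value does not recur later.\<close>

lemma card_image_last_occurrences:
  fixes A :: "'b::linorder set"
  assumes "finite A"
  shows "card (f ` A) = card {k \<in> A. \<forall>j\<in>A. k < j \<longrightarrow> f j \<noteq> f k}"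
  using assms
proof (induction A rule: finite_linorder_min_induct)
  case empty
  then show ?case by simp
next
  case (insert b A)
  have b: "b \<notin> A" using insert.hyps by auto
  have eq: "{k \<in> insert b A. \<forall>j\<in>insert b A. k < j \<longrightarrow> f j \<noteq> f k} =
      (if f b \<in> f ` A then {} else {b}) \<union> {k \<in> A. \<forall>j\<in>A. k < j \<longrightarrow> f j \<noteq> f k}"
    using insert.hyps by (auto simp: image_iff)
  show ?case
    unfolding eq using insert b by (auto simp: insert_absorb card_insert_if)
qed

lemma sum_diff_bounds_antimono:
  fixes p :: "nat \<Rightarrow> real"
  assumes "antimono p" "a \<le> b"
  shows "(real b - real a) * p b \<le> sum p {..<b} - sum p {..<a}"
    and "sum p {..<b} - sum p {..<a} \<le> (real b - real a) * p a"
proof -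
  have eq: "sum p {..<b} - sum p {..<a} = sum p {a..<b}"
    using assms(2) by (metis atLeast0LessThan sum_diff_nat_ivl zero_le)
  have "(\<Sum>m\<in>{a..<b}. p b) \<le> sum p {a..<b}" "sum p {a..<b} \<le> (\<Sum>m\<in>{a..<b}. p a)"
    by (intro sum_mono antimonoD[OF assms(1)]; simp)+
  then show "(real b - real a) * p b \<le> sum p {..<b} - sum p {..<a}"
    and "sum p {..<b} - sum p {..<a} \<le> (real b - real a) * p a"
    using assms(2) by (simp_all add: eq of_nat_diff)
qed

text \<open>The block from \<open>n\<close> to \<open>\<lfloor>y * real n\<rfloor>\<close> has at
  most \<open>(y - 1) * n\<close> terms, each at most \<open>p n\<close>. The left side is written
  as a difference quotient at 1 of the growth ratio, ready for the passage to a derivative.\<close>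

lemma last_term_ge_growth:
  fixes p :: "nat \<Rightarrow> real"
  assumes "antimono p" "\<And>m. 0 \<le> p m" "0 < sum p {..<n}" "1 < y"
  shows "(sum p {..<nat \<lfloor>y * real n\<rfloor>} / sum p {..<n} - 1) / (y - 1) \<le> real n / sum p {..<n} * p n"
proof -
  let ?b = "nat \<lfloor>y * real n\<rfloor>"
  have "real n \<le> y * real n" using assms(4) by (simp add: mult_le_cancel_right1)
  then have le: "n \<le> ?b" by (simp add: le_nat_floor)
  have b: "real ?b \<le> y * real n" using assms(4) by (simp add: of_nat_floor)
  have "sum p {..<?b} - sum p {..<n} \<le> (real ?b - real n) * p n"
    by (rule sum_diff_bounds_antimono[OF assms(1) le])
  also have "\<dots> \<le> (y * real n - real n) * p n"
    using b assms(2) by (intro mult_right_mono) auto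
  finally have "(sum p {..<?b} - sum p {..<n}) / (y - 1) \<le> real n * p n"
    using assms(4) by (simp add: pos_divide_le_eq algebra_simps)
  then have "(sum p {..<?b} - sum p {..<n}) / (y - 1) / sum p {..<n} \<le> real n * p n / sum p {..<n}"
    using assms(3) by (intro divide_right_mono) auto
  moreover have "sum p {..<?b} / sum p {..<n} - 1 = (sum p {..<?b} - sum p {..<n}) / sum p {..<n}"
    using assms(3) by (simp add: diff_divide_distrib)
  ultimately show ?thesis by (simp add: mult.commute)
qed

text \<open>Mirror image to the left of \<open>n\<close>: rounding down leaves at least
  \<open>(1 - x) * n\<close> terms in the block, each at least \<open>p n\<close>. Dividing by the
  negative \<open>x - 1\<close> gives the same difference quotient, now as an upper bound.\<close>

lemma last_term_le_growth:
  fixes p :: "nat \<Rightarrow> real"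
  assumes "antimono p" "\<And>m. 0 \<le> p m" "0 < sum p {..<n}" "0 < x" "x < 1"
  shows "real n / sum p {..<n} * p n \<le> (sum p {..<nat \<lfloor>x * real n\<rfloor>} / sum p {..<n} - 1) / (x - 1)"
proof -
  let ?a = "nat \<lfloor>x * real n\<rfloor>"
  have a: "real ?a \<le> x * real n" using assms(4) by (simp add: of_nat_floor)
  also have "\<dots> \<le> real n" using assms(5) by (simp add: mult_left_le_one_le assms(4) less_imp_le)
  finally have le: "?a \<le> n" by simp
  have "(real n - x * real n) * p n \<le> (real n - real ?a) * p n"
    using a assms(2) by (intro mult_right_mono) auto
  also have "\<dots> \<le> sum p {..<n} - sum p {..<?a}"
    by (rule sum_diff_bounds_antimono[OF assms(1) le])
  finally have "real n * p n \<le> (sum p {..<?a} - sum p {..<n}) / (x - 1)"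
    using assms(5) by (simp add: neg_le_divide_eq algebra_simps)
  then have "real n * p n / sum p {..<n} \<le> (sum p {..<?a} - sum p {..<n}) / (x - 1) / sum p {..<n}"
    using assms(3) by (intro divide_right_mono) auto
  moreover have "sum p {..<?a} / sum p {..<n} - 1 = (sum p {..<?a} - sum p {..<n}) / sum p {..<n}"
    using assms(3) by (simp add: diff_divide_distrib)
  ultimately show ?thesis by (simp add: mult.commute)
qed

lemma liminf_last_term_pos:
  fixes p :: "nat \<Rightarrow> real"
  assumes p: "antimono p" "\<And>m. 0 \<le> p m" "\<And>n. n \<ge> 1 \<Longrightarrow> 0 < sum p {..<n}" and y: "1 < y"
    and lim: "liminf (\<lambda>n. ereal (sum p {..<nat \<lfloor>y * real n\<rfloor>} / sum p {..<n})) > 1"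
  shows "liminf (\<lambda>n. ereal (real n / sum p {..<n} * p n)) > 0"
proof -
  \<comment> \<open>A real number strictly between 1 and the liminf: the ratio eventually exceeds
    \<open>c\<close>, which leaves the uniform positive bound
    \<open>(c - 1) / (y - 1)\<close>.\<close>
  obtain c where c: "1 < ereal c"
      "ereal c < liminf (\<lambda>n. ereal (sum p {..<nat \<lfloor>y * real n\<rfloor>} / sum p {..<n}))"
    using lim ereal_dense2 by blast
  then have c1: "1 < c" by (simp add: one_ereal_def)
  have "\<forall>\<^sub>F n in sequentially. c < sum p {..<nat \<lfloor>y * real n\<rfloor>} / sum p {..<n}"
    using less_LiminfD[OF c(2)] by simp
  then have "\<forall>\<^sub>F n in sequentially. ereal ((c - 1) / (y - 1)) \<le> ereal (real n / sum p {..<n} * p n)"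
    using eventually_ge_at_top[of "1::nat"]
  proof eventually_elim
    case (elim n)
    then have "(c - 1) / (y - 1) \<le> (sum p {..<nat \<lfloor>y * real n\<rfloor>} / sum p {..<n} - 1) / (y - 1)"
      using y by (intro divide_right_mono) auto
    then show ?case
      using last_term_ge_growth[OF p(1,2) p(3)[OF elim(2)] y] by simp
  qed
  then have "ereal ((c - 1) / (y - 1)) \<le> liminf (\<lambda>n. ereal (real n / sum p {..<n} * p n))"
    by (rule Liminf_bounded)
  moreover have "0 < ereal ((c - 1) / (y - 1))" using c1 y by simp
  ultimately show ?thesis by (rule less_le_trans[rotated])
qed

text \<open>For fixed \<open>x\<close> the two growth bounds converge, as \<open>n\<close> grows, to
  the difference quotient of \<open>x powr \<gamma>\<close> at 1. The derivative there is
  \<open>\<gamma>\<close>, so taking \<open>x\<close> close to 1 from either side squeezes the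
  limit.\<close>

lemma last_term_tendsto_index:
  fixes p :: "nat \<Rightarrow> real"
  assumes p: "antimono p" "\<And>m. 0 \<le> p m" and rv: "regularly_varying (\<lambda>n. sum p {..<n}) \<gamma>"
  shows "(\<lambda>n. real n / sum p {..<n} * p n) \<longlonglongrightarrow> \<gamma>"
proof -
  have pos: "0 < sum p {..<n}" if "n \<ge> 1" for n
    using rv that by (auto simp: regularly_varying_def)
  have quot: "(\<lambda>n. (sum p {..<nat \<lfloor>x * real n\<rfloor>} / sum p {..<n} - 1) / (x - 1))
      \<longlonglongrightarrow> (x powr \<gamma> - 1) / (x - 1)" if "0 < x" "x \<noteq> 1" for x
    using rv that by (intro tendsto_intros) (auto simp: regularly_varying_def)
  have "((\<lambda>x::real. x powr \<gamma>) has_real_derivative \<gamma> * 1 powr (\<gamma> - 1)) (at 1)"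
    by (rule has_real_derivative_powr) simp
  then have "((\<lambda>x::real. (x powr \<gamma> - 1) / (x - 1)) \<longlongrightarrow> \<gamma>) (at 1)"
    by (simp add: has_field_derivative_iff)
  then have right: "((\<lambda>x::real. (x powr \<gamma> - 1) / (x - 1)) \<longlongrightarrow> \<gamma>) (at_right 1)"
    and left: "((\<lambda>x::real. (x powr \<gamma> - 1) / (x - 1)) \<longlongrightarrow> \<gamma>) (at_left 1)"
    by (simp_all add: filterlim_at_split)
  show ?thesis
  proof (rule order_tendstoI)
    fix a assume "a < \<gamma>"
    \<comment> \<open>One \<open>x\<close> is fixed first and only then does \<open>n\<close> tend
      to infinity, so no limits are interchanged. Values above 1 serve the lower bound, values below
      1 the upper bound.\<close>
    then have "\<forall>\<^sub>F x in at_right (1::real). a < (x powr \<gamma> - 1) / (x - 1) \<and> 1 < x"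
      by (intro eventually_conj order_tendstoD(1)[OF right] eventually_at_right_less)
    then obtain x :: real where x: "a < (x powr \<gamma> - 1) / (x - 1)" "1 < x"
      using eventually_happens'[OF trivial_limit_at_right_real] by blast
    have "\<forall>\<^sub>F n in sequentially. a < (sum p {..<nat \<lfloor>x * real n\<rfloor>} / sum p {..<n} - 1) / (x - 1)"
      using order_tendstoD(1)[OF quot x(1)] x(2) by simp
    then show "\<forall>\<^sub>F n in sequentially. a < real n / sum p {..<n} * p n"
      using eventually_ge_at_top[of "1::nat"]
      by eventually_elim (use last_term_ge_growth[OF p pos x(2)] in force)
  next
    fix a assume "\<gamma> < a"
    then have "\<forall>\<^sub>F x in at_left (1::real). (x powr \<gamma> - 1) / (x - 1) < a \<and> x \<in> {0<..<1}"
      by (intro eventually_conj order_tendstoD(2)[OF left] eventually_at_left_real) simp_all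
    then obtain x :: real where x: "(x powr \<gamma> - 1) / (x - 1) < a" "0 < x" "x < 1"
      using eventually_happens'[OF trivial_limit_at_left_real] by force
    have "\<forall>\<^sub>F n in sequentially. (sum p {..<nat \<lfloor>x * real n\<rfloor>} / sum p {..<n} - 1) / (x - 1) < a"
      using order_tendstoD(2)[OF quot x(1)] x(2,3) by simp
    then show "\<forall>\<^sub>F n in sequentially. real n / sum p {..<n} * p n < a"
      using eventually_ge_at_top[of "1::nat"]
      by eventually_elim (use last_term_le_growth[OF p pos x(2,3)] in force)
  qed
qed

section \<open>Path events, the return time and signs of paths\<close>

text \<open>Both sides are the mass that the common law gives to the set of paths satisfying
  \<open>P\<close>. Stationarity and symmetry enter the proof only through this transfer.\<close>

lemma measure_eq_of_process_law_eq:
  assumes X: "int_process M X" and Y: "int_process M Y"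
    and law: "process_law M X = process_law M Y"
    and P: "Measurable.pred (\<Pi>\<^sub>M n\<in>(UNIV :: nat set). count_space (UNIV :: int set)) P"
  shows "measure M {\<omega> \<in> space M. P (\<lambda>n. X n \<omega>)} = measure M {\<omega> \<in> space M. P (\<lambda>n. Y n \<omega>)}"
proof -
  let ?N = "\<Pi>\<^sub>M n\<in>(UNIV :: nat set). count_space (UNIV :: int set)"
  have *: "measure (process_law M W) {f \<in> space ?N. P f} = measure M {\<omega> \<in> space M. P (\<lambda>n. W n \<omega>)}"
    if W: "int_process M W" for W :: "nat \<Rightarrow> 'a \<Rightarrow> int"
  proof -
    have meas: "(\<lambda>\<omega> n. W n \<omega>) \<in> M \<rightarrow>\<^sub>M ?N"
      using W by (intro measurable_PiM_single') (auto simp: int_process_def)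
    have "{f \<in> space ?N. P f} \<in> sets ?N"
      using P by measurable
    then have "measure (process_law M W) {f \<in> space ?N. P f} =
        measure M ((\<lambda>\<omega> n. W n \<omega>) -` {f \<in> space ?N. P f} \<inter> space M)"
      unfolding process_law_def by (rule measure_distr[OF meas])
    also have "(\<lambda>\<omega> n. W n \<omega>) -` {f \<in> space ?N. P f} \<inter> space M = {\<omega> \<in> space M. P (\<lambda>n. W n \<omega>)}"
      by (auto simp: space_PiM)
    finally show ?thesis .
  qed
  show ?thesis
    using *[OF X] *[OF Y] law by simp
qed

lemma less_return_time_iff:
  "enat n < return_time Z \<omega> \<longleftrightarrow> (\<forall>j\<in>{1..n}. Z j \<omega> \<noteq> 0)"
proof -
  have "enat n < return_time Z \<omega> \<longleftrightarrow> \<not> (\<exists>j. j \<ge> 1 \<and> Z j \<omega> = 0 \<and> j \<le> n)"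
  proof
    assume *: "enat n < return_time Z \<omega>"
    show "\<not> (\<exists>j. j \<ge> 1 \<and> Z j \<omega> = 0 \<and> j \<le> n)"
    proof
      assume "\<exists>j. j \<ge> 1 \<and> Z j \<omega> = 0 \<and> j \<le> n"
      then obtain j where "j \<ge> 1" "Z j \<omega> = 0" "j \<le> n" by blast
      then have "return_time Z \<omega> \<le> enat j"
        unfolding return_time_def by (intro Inf_lower) auto
      with * \<open>j \<le> n\<close> show False by (metis enat_ord_simps(1) leD order_trans)
    qed
  next
    assume *: "\<not> (\<exists>j. j \<ge> 1 \<and> Z j \<omega> = 0 \<and> j \<le> n)"
    \<comment> \<open>Passing to the successor turns the strict inequality into a lower bound for an
      infimum; this also covers a path that never returns, where the infimum is infinite.\<close>
    have "enat (Suc n) \<le> return_time Z \<omega>"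
      unfolding return_time_def using * by (intro Inf_greatest) (auto simp: not_le Suc_le_eq)
    then show "enat n < return_time Z \<omega>"
      by (simp add: Suc_ile_eq)
  qed
  then show ?thesis by auto
qed

lemma no_return_prob_eq:
  "no_return_prob M Z n = measure M {\<omega> \<in> space M. \<forall>j\<in>{1..n}. Z j \<omega> \<noteq> 0}"
  by (simp only: no_return_prob_def less_return_time_iff)

text \<open>Changing sign without visiting 0 would take a step of size at least 2.\<close>

lemma constant_sign_of_unit_steps:
  fixes f :: "nat \<Rightarrow> int"
  assumes "\<And>k. k \<ge> 1 \<Longrightarrow> f (Suc k) - f k \<in> {-1, 0, 1}" "\<forall>j\<in>{1..n}. f j \<noteq> 0"
  shows "(\<forall>j\<in>{1..n}. f j < 0) \<or> (\<forall>j\<in>{1..n}. f j > 0)"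
  using assms(2)
proof (induction n)
  case (Suc n)
  show ?case
  \<comment> \<open>The first index has no predecessor in the range, so its sign is
    unconstrained.\<close>
  proof (cases "n = 0")
    case True
    then show ?thesis using Suc.prems by auto
  next
    case False
    have "f n \<noteq> 0" "f (Suc n) \<noteq> 0" "f (Suc n) - f n \<in> {-1, 0, 1}"
      using Suc.prems assms(1)[of n] False by auto
    then have "f (Suc n) < 0 \<longleftrightarrow> f n < 0" "f (Suc n) > 0 \<longleftrightarrow> f n > 0"
      by auto
    moreover have "(\<forall>j\<in>{1..n}. f j < 0) \<or> (\<forall>j\<in>{1..n}. f j > 0)"
      using Suc by auto
    moreover have "n \<in> {1..n}" using False by simp
    ultimately show ?thesis
      by (metis atLeastAtMost_iff le_Suc_eq)
  qed
qed simp

section \<open>Mean range and return probabilities under stationary increments\<close>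

locale stationary_increments_process = prob_space M
  for M :: "'a measure" and Z :: "nat \<Rightarrow> 'a \<Rightarrow> int" +
  assumes int_process: "int_process M Z"
    and stationary: "stationary_increments M Z"
begin

lemma measurable_Z [measurable]: "Z n \<in> M \<rightarrow>\<^sub>M count_space UNIV"
  using int_process by (simp add: int_process_def)

lemma prob_increments_eq:
  assumes "Measurable.pred (\<Pi>\<^sub>M n\<in>(UNIV :: nat set). count_space (UNIV :: int set)) P"
  shows "prob {\<omega> \<in> space M. P (\<lambda>n. Z (n + k) \<omega> - Z k \<omega>)} = prob {\<omega> \<in> space M. P (\<lambda>n. Z n \<omega>)}"
proof (rule measure_eq_of_process_law_eq[OF _ int_process _ assms])
  show "int_process M (\<lambda>n \<omega>. Z (n + k) \<omega> - Z k \<omega>)"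
    by (simp add: int_process_def)
  show "process_law M (\<lambda>n \<omega>. Z (n + k) \<omega> - Z k \<omega>) = process_law M Z"
    using stationary by (simp add: stationary_increments_def)
qed

text \<open>Time \<open>k\<close> is the last visit to its site up to \<open>n\<close> exactly when
  the path restarted at \<open>k\<close> avoids 0 during its first \<open>n - k\<close> steps.
  Stationarity removes the shift.\<close>

lemma prob_last_visit:
  assumes "k \<le> n"
  shows "prob {\<omega> \<in> space M. \<forall>j\<in>{k<..n}. Z j \<omega> \<noteq> Z k \<omega>} = no_return_prob M Z (n - k)"
proof -
  have "(\<forall>j\<in>{k<..n}. Z j \<omega> \<noteq> Z k \<omega>) \<longleftrightarrow> (\<forall>j\<in>{1..n-k}. Z (j + k) \<omega> - Z k \<omega> \<noteq> 0)" for \<omega>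
  proof
    assume *: "\<forall>j\<in>{1..n-k}. Z (j + k) \<omega> - Z k \<omega> \<noteq> 0"
    show "\<forall>j\<in>{k<..n}. Z j \<omega> \<noteq> Z k \<omega>"
    proof
      fix j assume "j \<in> {k<..n}"
      then show "Z j \<omega> \<noteq> Z k \<omega>" using bspec[OF *, of "j - k"] by fastforce
    qed
  qed (use assms in auto)
  then show ?thesis
    using prob_increments_eq[of "\<lambda>f. \<forall>j\<in>{1..n-k}. f j \<noteq> 0" k]
    by (simp add: no_return_prob_eq)
qed

text \<open>The range is the number of times \<open>k\<close> that are last visits to their sites,
  hence a sum of indicators; its expectation is a sum of no-return probabilities.\<close>

lemma mean_range_eq_sum: "mean_range M Z n = (\<Sum>m<n. no_return_prob M Z m)"
proof -
  let ?L = "\<lambda>k. {\<omega> \<in> space M. \<forall>j\<in>{k<..n}. Z j \<omega> \<noteq> Z k \<omega>}"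
  have L: "?L k \<in> events" for k by measurable
  have "mean_range M Z n = (\<integral>\<omega>. (\<Sum>k\<in>{1..n}. indicat_real (?L k) \<omega>) \<partial>M)"
    unfolding mean_range_def
  proof (rule Bochner_Integration.integral_cong[OF refl])
    fix \<omega> assume "\<omega> \<in> space M"
    have "{k \<in> {1..n}. \<forall>j\<in>{1..n}. k < j \<longrightarrow> Z j \<omega> \<noteq> Z k \<omega>} = {k \<in> {1..n}. \<omega> \<in> ?L k}"
      using \<open>\<omega> \<in> space M\<close> by auto
    then have "range_size Z n \<omega> = card {k \<in> {1..n}. \<omega> \<in> ?L k}"
      unfolding range_size_def by (subst card_image_last_occurrences) auto
    then show "real (range_size Z n \<omega>) = (\<Sum>k\<in>{1..n}. indicat_real (?L k) \<omega>)"
      by (simp add: indicator_def sum.If_cases Int_def)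
  qed
  also have "\<dots> = (\<Sum>k\<in>{1..n}. prob (?L k))"
    using L by (subst Bochner_Integration.integral_sum)
      (auto intro!: integrable_real_indicator simp: emeasure_eq_measure)
  also have "\<dots> = (\<Sum>k\<in>{1..n}. no_return_prob M Z (n - k))"
    by (intro sum.cong refl prob_last_visit) simp
  \<comment> \<open>The remaining time \<open>m = n - k\<close> runs from 0 to \<open>n - 1\<close>
    as \<open>k\<close> runs from \<open>n\<close> down to 1.\<close>
  also have "\<dots> = (\<Sum>m<n. no_return_prob M Z m)"
    by (rule sum.reindex_bij_witness[of _ "\<lambda>m. n - m" "\<lambda>k. n - k"]) auto
  finally show ?thesis .
qed

lemma antimono_no_return_prob: "antimono (no_return_prob M Z)"
proof (rule antimonoI)
  fix m n :: nat assume "m \<le> n"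
  then show "no_return_prob M Z n \<le> no_return_prob M Z m"
    unfolding no_return_prob_eq by (intro finite_measure_mono) auto
qed

lemma no_return_prob_nonneg: "0 \<le> no_return_prob M Z n"
  by (simp add: no_return_prob_def)

lemma sum_no_return_prob_pos:
  assumes "n \<ge> 1"
  shows "0 < (\<Sum>m<n. no_return_prob M Z m)"
proof -
  \<comment> \<open>No time lies in \<open>{1..0}\<close>, so the event is the whole space.\<close>
  have "no_return_prob M Z 0 = 1"
    by (simp add: no_return_prob_eq prob_space)
  then show ?thesis
    using assms no_return_prob_nonneg by (intro sum_pos2[of _ 0]) auto
qed

text \<open>The mean range is a sum of \<open>n\<close> terms, none of them smaller than the term at
  \<open>n\<close>.\<close>

lemma no_return_prob_le:
  assumes "n \<ge> 1"
  shows "no_return_prob M Z n \<le> mean_range M Z n / real n"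
  using sum_diff_bounds_antimono(1)[OF antimono_no_return_prob, of 0 n] assms
  by (simp add: mean_range_eq_sum field_simps)

text \<open>Each step is the value at time 1 of a shifted path, so it has the law of
  \<open>Z 1\<close>; countably many null sets are then discarded together.\<close>

lemma AE_unit_steps:
  assumes "prob {\<omega> \<in> space M. Z 1 \<omega> \<in> {-1, 0, 1}} = 1"
  shows "AE \<omega> in M. \<forall>k. Z (Suc k) \<omega> - Z k \<omega> \<in> {-1, 0, 1}"
proof (subst AE_all_countable, rule allI)
  fix k
  have "prob {\<omega> \<in> space M. Z (Suc k) \<omega> - Z k \<omega> \<in> {-1, 0, 1}} = 1"
    using prob_increments_eq[of "\<lambda>f. f 1 \<in> {-1, 0, 1}" k] assms by simp
  then show "AE \<omega> in M. Z (Suc k) \<omega> - Z k \<omega> \<in> {-1, 0, 1}"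
    by (subst (asm) prob_Collect_eq_1) simp_all
qed

section \<open>The running maximum of a symmetric process with unit steps\<close>

text \<open>Up to a null set, avoiding 0 splits into staying negative and staying positive, and
  symmetry makes these equally likely. For integers, a maximum of at most -1 means staying
  negative.\<close>

lemma prob_running_max_neg:
  assumes steps: "prob {\<omega> \<in> space M. Z 1 \<omega> \<in> {-1, 0, 1}} = 1"
    and sym: "process_law M (\<lambda>n \<omega>. - Z n \<omega>) = process_law M Z" and n: "n \<ge> 1"
  shows "prob {\<omega> \<in> space M. running_max Z n \<omega> \<le> -1} = 1 / 2 * no_return_prob M Z n"
proof -
  let ?neg = "{\<omega> \<in> space M. \<forall>j\<in>{1..n}. Z j \<omega> < 0}"
  let ?pos = "{\<omega> \<in> space M. \<forall>j\<in>{1..n}. Z j \<omega> > 0}"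
  have "running_max Z n \<omega> \<le> -1 \<longleftrightarrow> (\<forall>j\<in>{1..n}. Z j \<omega> < 0)" for \<omega>
    using n unfolding running_max_def by (subst Max_le_iff) (auto simp: zle_diff1_eq[of _ 0, simplified])
  then have neg: "prob {\<omega> \<in> space M. running_max Z n \<omega> \<le> -1} = prob ?neg"
    by simp
  have "int_process M (\<lambda>n \<omega>. - Z n \<omega>)"
    by (simp add: int_process_def)
  from measure_eq_of_process_law_eq[OF this int_process sym, of "\<lambda>f. \<forall>j\<in>{1..n}. f j < 0"]
  have "prob ?pos = prob ?neg" by simp
  moreover have "no_return_prob M Z n = prob (?neg \<union> ?pos)"
    unfolding no_return_prob_eq
  proof (rule finite_measure_eq_AE)
    show "AE \<omega> in M. \<omega> \<in> {\<omega> \<in> space M. \<forall>j\<in>{1..n}. Z j \<omega> \<noteq> 0} \<longleftrightarrow> \<omega> \<in> ?neg \<union> ?pos"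
      using AE_unit_steps[OF steps]
    proof eventually_elim
      case (elim \<omega>)
      then show ?case
        using constant_sign_of_unit_steps[of "\<lambda>k. Z k \<omega>" n] by fastforce
    qed
  qed measurable
  moreover have "prob (?neg \<union> ?pos) = prob ?neg + prob ?pos"
  proof (rule finite_measure_Union)
    \<comment> \<open>Disjointness rests on \<open>n \<ge> 1\<close>: with no times to test, both
      events would be the whole space.\<close>
    show "?neg \<inter> ?pos = {}" using n by force
  qed measurable
  ultimately show ?thesis
    using neg by simp
qed

lemma running_max_neg_asymp:
  assumes steps: "prob {\<omega> \<in> space M. Z 1 \<omega> \<in> {-1, 0, 1}} = 1"
    and sym: "process_law M (\<lambda>n \<omega>. - Z n \<omega>) = process_law M Z"
    and lim: "(\<lambda>n. real n / mean_range M Z n * no_return_prob M Z n) \<longlonglongrightarrow> \<gamma>" and "\<gamma> \<noteq> 0"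
  shows "(\<lambda>n. prob {\<omega> \<in> space M. running_max Z n \<omega> \<le> -1})
    \<sim>[sequentially] (\<lambda>n. \<gamma> * mean_range M Z n / (2 * real n))"
proof (rule asymp_equivI')
  have "(\<lambda>n. real n / mean_range M Z n * no_return_prob M Z n / \<gamma>) \<longlonglongrightarrow> \<gamma> / \<gamma>"
    using lim \<open>\<gamma> \<noteq> 0\<close> by (intro tendsto_intros)
  then have "(\<lambda>n. real n / mean_range M Z n * no_return_prob M Z n / \<gamma>) \<longlonglongrightarrow> 1"
    using \<open>\<gamma> \<noteq> 0\<close> by simp
  \<comment> \<open>By the exact identity for \<open>n \<ge> 1\<close> the factors 1/2 cancel, so
    the ratio of the two sides is the given convergent sequence divided by
    \<open>\<gamma>\<close>.\<close>
  moreover have "\<forall>\<^sub>F n in sequentially. real n / mean_range M Z n * no_return_prob M Z n / \<gamma> =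
      prob {\<omega> \<in> space M. running_max Z n \<omega> \<le> -1} / (\<gamma> * mean_range M Z n / (2 * real n))"
    using eventually_ge_at_top[of "1::nat"]
    by eventually_elim (simp add: prob_running_max_neg[OF steps sym] mult.commute)
  ultimately show "(\<lambda>n. prob {\<omega> \<in> space M. running_max Z n \<omega> \<le> -1} /
      (\<gamma> * mean_range M Z n / (2 * real n))) \<longlonglongrightarrow> 1"
    by (rule Lim_transform_eventually)
qed

end

theorem theorem3:
  fixes M :: "'a measure" and Z :: "nat \<Rightarrow> 'a \<Rightarrow> int"
  assumes "prob_space M"
    and "int_process M Z"
    and "stationary_increments M Z"
  shows "(\<forall>n\<ge>1. no_return_prob M Z n \<le> mean_range M Z n / real n)
    \<and> ((\<exists>y::real. y > 1 \<and>
            liminf (\<lambda>n. ereal (mean_range M Z (nat \<lfloor>y * real n\<rfloor>) / mean_range M Z n)) > 1)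
        \<longrightarrow> liminf (\<lambda>n. ereal (real n / mean_range M Z n * no_return_prob M Z n)) > 0)
    \<and> (\<forall>\<gamma>::real. 0 < \<gamma> \<and> \<gamma> < 1 \<and> regularly_varying (mean_range M Z) \<gamma>
        \<longrightarrow> (\<lambda>n. real n / mean_range M Z n * no_return_prob M Z n) \<longlonglongrightarrow> \<gamma>)
    \<and> (\<forall>\<gamma>::real. 0 < \<gamma> \<and> \<gamma> < 1
        \<and> measure M {\<omega> \<in> space M. Z 1 \<omega> \<in> {-1, 0, 1}} = 1
        \<and> process_law M (\<lambda>n \<omega>. - Z n \<omega>) = process_law M Z
        \<and> (\<lambda>n. real n / mean_range M Z n * no_return_prob M Z n) \<longlonglongrightarrow> \<gamma>
        \<longrightarrow> (\<forall>n\<ge>1. measure M {\<omega> \<in> space M. running_max Z n \<omega> \<le> -1}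
                     = 1 / 2 * no_return_prob M Z n)
          \<and> (\<lambda>n. measure M {\<omega> \<in> space M. running_max Z n \<omega> \<le> -1})
               \<sim>[sequentially] (\<lambda>n. \<gamma> * mean_range M Z n / (2 * real n)))"
proof -
  interpret stationary_increments_process M Z
    using assms by (simp add: stationary_increments_process_def stationary_increments_process_axioms_def)
  note p = antimono_no_return_prob no_return_prob_nonneg
  \<comment> \<open>An equality of functions, so that it also rewrites the argument of
    \<open>regularly_varying\<close> and the values at rounded indices.\<close>
  have r: "mean_range M Z = (\<lambda>n. \<Sum>m<n. no_return_prob M Z m)"
    using mean_range_eq_sum by blast
  show ?thesis
  proof (intro conjI impI allI; (elim exE conjE)?)
    fix n :: nat assume "n \<ge> 1"
    then show "no_return_prob M Z n \<le> mean_range M Z n / real n"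
      by (rule no_return_prob_le)
  next
    fix y :: real
    assume "y > 1" "liminf (\<lambda>n. ereal (mean_range M Z (nat \<lfloor>y * real n\<rfloor>) / mean_range M Z n)) > 1"
    then show "liminf (\<lambda>n. ereal (real n / mean_range M Z n * no_return_prob M Z n)) > 0"
      unfolding r using liminf_last_term_pos[OF p sum_no_return_prob_pos] by blast
  next
    fix \<gamma> :: real assume "regularly_varying (mean_range M Z) \<gamma>"
    then show "(\<lambda>n. real n / mean_range M Z n * no_return_prob M Z n) \<longlonglongrightarrow> \<gamma>"
      unfolding r by (rule last_term_tendsto_index[OF p])
  qed (use prob_running_max_neg running_max_neg_asymp in auto)
qed

end
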